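(* Let $\mathcal{H}$ be a complex Hilbert space and let $T\in\mathcal{B}(\mathcal{H})$ have closed range, with Moore-Penrose inverse $T^{\dag}$. Then the following are equivalent: (1) $T$ is EP. (2) There exists an isomorphism $V\in\mathcal{B}(\mathcal{H})$ such that $T^{\dag}=VT=TV$. (3) There exists an injective $N\in\mathcal{B}(\mathcal{H})$ such that $T^{\dag}=NT$. (4) There exist $S_1,S_2\in\mathcal{B}(\mathcal{H})$ such that $T^{\dag}=S_1T$ and $T=S_2T^{\dag}$.
   Context: $\mathcal{B}(\mathcal{H})$ denotes the bounded linear operators on $\mathcal{H}$. $\mathcal{N}(T)$ is the kernel of $T$ and $T^*$ its adjoint. An operator $T\in\mathcal{B}(\mathcal{H})$ with closed range is called EP if $\mathcal{N}(T)=\mathcal{N}(T^* )$. A bounded operator is an isomorphism if it is injective and onto (not necessarily isometric). The Moore-Penrose inverse of $T\in\mathcal{B}(\mathcal{H})$ with closed range is the unique $T^{\dag}\in\mathcal{B}(\mathcal{H})$ satisfying $TT^{\dag}T=T$, $T^{\dag}TT^{\dag}=T^{\dag}$, $(TT^{\dag})^*=TT^{\dag}$ and $(T^{\dag}T)^*=T^{\dag}T$. *)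

theory Defs
  imports "HOL-Analysis.Analysis"
begin

text \<open>
  The distribution provides only real inner product spaces. A complex Hilbert space is
  introduced here as a Banach space whose real scalar multiplication is the restriction of a
  complex one and whose norm is induced by a sesquilinear form. The zero space is not
  excluded. The inner product is linear in its first argument; its positivity and
  definiteness are both contained in \<open>cinner_self\<close>.
\<close>

class complex_hilbert_space = banach +
  fixes scaleC :: "complex \<Rightarrow> 'a \<Rightarrow> 'a"  (infixr \<open>*\<^sub>C\<close> 75)
    and cinner :: "'a \<Rightarrow> 'a \<Rightarrow> complex"
  assumes scaleR_scaleC: "r *\<^sub>R x = complex_of_real r *\<^sub>C x"
    and scaleC_add_right: "c *\<^sub>C (x + y) = c *\<^sub>C x + c *\<^sub>C y"
    and scaleC_add_left: "(c + d) *\<^sub>C x = c *\<^sub>C x + d *\<^sub>C x"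
    and scaleC_scaleC: "c *\<^sub>C d *\<^sub>C x = (c * d) *\<^sub>C x"
    and cinner_add_left: "cinner (x + y) z = cinner x z + cinner y z"
    and cinner_scaleC_left: "cinner (c *\<^sub>C x) y = c * cinner x y"
    and cinner_commute: "cinner x y = cnj (cinner y x)"
    and cinner_self: "cinner x x = complex_of_real ((norm x)\<^sup>2)"

instantiation complex :: complex_hilbert_space
begin

definition scaleC_complex :: "complex \<Rightarrow> complex \<Rightarrow> complex"
  where "scaleC_complex c x = c * x"

definition cinner_complex :: "complex \<Rightarrow> complex \<Rightarrow> complex"
  where "cinner_complex x y = x * cnj y"

instance
  by standard
    (auto simp: scaleC_complex_def cinner_complex_def scaleR_conv_of_real algebra_simps
      complex_norm_square simp flip: of_real_power)

end

definition bounded_operator :: "('a::complex_hilbert_space \<Rightarrow> 'a) \<Rightarrow> bool"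
  where "bounded_operator T \<longleftrightarrow> bounded_linear T \<and> (\<forall>c x. T (c *\<^sub>C x) = c *\<^sub>C T x)"

definition kernel :: "('a::complex_hilbert_space \<Rightarrow> 'a) \<Rightarrow> 'a set"
  where "kernel T = {x. T x = 0}"

text \<open>
  For a bounded operator the description below determines exactly one function, by the
  Riesz representation theorem; for other functions the value is irrelevant.
\<close>

definition adjoint_op :: "('a::complex_hilbert_space \<Rightarrow> 'a) \<Rightarrow> 'a \<Rightarrow> 'a"
  where "adjoint_op T = (THE S. \<forall>x y. cinner (T x) y = cinner x (S y))"

definition isomorphism_op :: "('a::complex_hilbert_space \<Rightarrow> 'a) \<Rightarrow> bool"
  where "isomorphism_op V \<longleftrightarrow> bounded_operator V \<and> inj V \<and> surj V"

definition EP :: "('a::complex_hilbert_space \<Rightarrow> 'a) \<Rightarrow> bool"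
  where "EP T \<longleftrightarrow>
    bounded_operator T \<and> closed (range T) \<and> kernel T = kernel (adjoint_op T)"

definition is_moore_penrose ::
    "('a::complex_hilbert_space \<Rightarrow> 'a) \<Rightarrow> ('a \<Rightarrow> 'a) \<Rightarrow> bool"
  where "is_moore_penrose T X \<longleftrightarrow>
    bounded_operator X \<and>
    T \<circ> X \<circ> T = T \<and>
    X \<circ> T \<circ> X = X \<and>
    adjoint_op (T \<circ> X) = T \<circ> X \<and>
    adjoint_op (X \<circ> T) = X \<circ> T"

text \<open>
  Meaningful for bounded operators with closed range, for which exactly one Moore-Penrose
  inverse exists.
\<close>

definition moore_penrose :: "('a::complex_hilbert_space \<Rightarrow> 'a) \<Rightarrow> 'a \<Rightarrow> 'a"
  where "moore_penrose T = (THE X. is_moore_penrose T X)"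

end

theory Submission imports Defs begin

text \<open>
  Let \<open>X\<close> be the Moore-Penrose inverse of \<open>T\<close>. The kernel of \<open>X\<close> is that of the adjoint of \<open>T\<close>
  (\<open>kernel_moore_penrose\<close>), so that \<open>T\<close> is EP exactly if \<open>T\<close> and \<open>X\<close> have the same kernel. Each
  of the three factorizations implies this: \<open>X = N \<circ> T\<close> with \<open>N\<close> injective, in particular with
  \<open>N\<close> an isomorphism, makes the kernels equal, and \<open>X = S1 \<circ> T\<close>, \<open>T = S2 \<circ> X\<close> give one inclusion
  each.

  Conversely, if the kernels agree, then \<open>T \<circ> X\<close> and \<open>X \<circ> T\<close> are orthogonal projections with the
  same kernel, hence equal (\<open>moore_penrose_commute_if_kernel_eq\<close>). Call this projection \<open>P\<close>.
  Then \<open>V = X \<circ> X + (1 - P)\<close> satisfies \<open>V \<circ> T = T \<circ> V = X\<close> and has the inverse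
  \<open>T \<circ> T + (1 - P)\<close>, while \<open>T = (T \<circ> T) \<circ> X\<close>.

  The bulk of the work is the existence of \<open>X\<close> (\<open>moore_penrose_existence\<close>), starting from
  orthogonal projections and the Riesz representation theorem. As a linear map, \<open>X\<close> sends \<open>y\<close> to
  the vector orthogonal to the kernel of \<open>T\<close> whose image under \<open>T\<close> is the projection of \<open>y\<close> onto
  the range of \<open>T\<close>. To see that it is bounded, note that the range of the adjoint of \<open>T\<close> is dense
  in the orthogonal complement of the kernel, and that \<open>cinner (X y) (adjoint_op T v)\<close> equals
  \<open>cinner (T (X y)) v\<close>, which is continuous in \<open>y\<close> because \<open>T \<circ> X\<close> is a projection. So the sets
  \<open>{y. norm (X y) \<le> n}\<close> are closed, and by the Baire category theorem one of them contains a ball.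
\<close>

section \<open>Complex inner products\<close>

lemma cinner_add_right: "cinner x (y + z) = cinner x y + cinner x z"
  by (metis cinner_add_left cinner_commute complex_cnj_add)

lemma cinner_scaleC_right: "cinner x (c *\<^sub>C y) = cnj c * cinner x y"
  by (metis cinner_commute cinner_scaleC_left complex_cnj_mult)

lemma cinner_zero_left [simp]: "cinner 0 x = 0"
  using cinner_add_left[of 0 0 x] by simp

lemma cinner_zero_right [simp]: "cinner x 0 = 0"
  using cinner_add_right[of x 0 0] by simp

lemma cinner_diff_left: "cinner (x - y) z = cinner x z - cinner y z"
  using cinner_add_left[of "x - y" y z] by simp

lemma cinner_diff_right: "cinner x (y - z) = cinner x y - cinner x z"
  using cinner_add_right[of x "y - z" z] by simp

lemma cinner_self_eq_0_iff [simp]: "cinner x x = 0 \<longleftrightarrow> x = 0"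
  by (simp add: cinner_self)

lemma cinner_eq_0_commute: "cinner x y = 0 \<longleftrightarrow> cinner y x = 0"
  by (metis cinner_commute complex_cnj_zero)

lemma cinner_left_ext: "(\<And>x. cinner x y = cinner x z) \<Longrightarrow> y = z"
  by (metis cinner_diff_right cinner_self_eq_0_iff eq_iff_diff_eq_0)

lemma norm_eq_Re_cinner: "(norm x)\<^sup>2 = Re (cinner x x)"
  by (simp add: cinner_self)

lemma Re_cinner_commute: "Re (cinner x y) = Re (cinner y x)"
  by (subst cinner_commute) simp

lemma norm_add_sq: "(norm (x + y))\<^sup>2 = (norm x)\<^sup>2 + (norm y)\<^sup>2 + 2 * Re (cinner x y)"
  using Re_cinner_commute[of y x]
  by (simp add: norm_eq_Re_cinner cinner_add_left cinner_add_right)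

lemma norm_diff_sq: "(norm (x - y))\<^sup>2 = (norm x)\<^sup>2 + (norm y)\<^sup>2 - 2 * Re (cinner x y)"
  using Re_cinner_commute[of y x]
  by (simp add: norm_eq_Re_cinner cinner_diff_left cinner_diff_right)

lemma norm_scaleC_sq: "(norm (c *\<^sub>C x))\<^sup>2 = (cmod c)\<^sup>2 * (norm x)\<^sup>2"
proof -
  have "cinner (c *\<^sub>C x) (c *\<^sub>C x) = c * cnj c * cinner x x"
    by (simp add: cinner_scaleC_left cinner_scaleC_right)
  then have "complex_of_real ((norm (c *\<^sub>C x))\<^sup>2) = complex_of_real ((cmod c)\<^sup>2 * (norm x)\<^sup>2)"
    by (simp only: cinner_self complex_norm_square of_real_mult)
  then show ?thesis
    by (simp only: of_real_eq_iff)
qed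

text \<open>
  The left-hand side is the squared norm of \<open>x\<close> minus its component along \<open>y\<close>. That it is
  nonnegative is the Cauchy--Schwarz inequality; that it is smaller than \<open>(norm x)\<^sup>2\<close> unless
  \<open>x\<close> and \<open>y\<close> are orthogonal is what makes the nearest point of a subspace the foot of a
  perpendicular.
\<close>

lemma norm_sub_component_sq:
  assumes "y \<noteq> 0"
  shows "(norm (x - (cinner x y / complex_of_real ((norm y)\<^sup>2)) *\<^sub>C y))\<^sup>2
    = (norm x)\<^sup>2 - (cmod (cinner x y))\<^sup>2 / (norm y)\<^sup>2"
proof -
  let ?c = "cinner x y / complex_of_real ((norm y)\<^sup>2)"
  have "cinner x (?c *\<^sub>C y) = complex_of_real ((cmod (cinner x y))\<^sup>2 / (norm y)\<^sup>2)"
    unfolding cinner_scaleC_right of_real_divide complex_norm_square by simp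
  then have "Re (cinner x (?c *\<^sub>C y)) = (cmod (cinner x y))\<^sup>2 / (norm y)\<^sup>2"
    by (simp only: Re_complex_of_real)
  moreover have "(cmod ?c)\<^sup>2 * (norm y)\<^sup>2 = (cmod (cinner x y))\<^sup>2 / (norm y)\<^sup>2"
    using assms by (simp add: norm_divide power_divide power2_eq_square norm_mult)
  ultimately show ?thesis
    by (simp only: norm_diff_sq norm_scaleC_sq)
qed

lemma cmod_cinner_le: "cmod (cinner x y) \<le> norm x * norm y"
proof (cases "y = 0")
  case False
  then have "(cmod (cinner x y))\<^sup>2 / (norm y)\<^sup>2 \<le> (norm x)\<^sup>2"
    using norm_sub_component_sq[OF False, of x]
      zero_le_power2[of "norm (x - (cinner x y / complex_of_real ((norm y)\<^sup>2)) *\<^sub>C y)"]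
    by linarith
  with False have "(cmod (cinner x y))\<^sup>2 \<le> (norm x * norm y)\<^sup>2"
    by (simp add: divide_simps power_mult_distrib)
  then show ?thesis
    by (rule power2_le_imp_le) simp
qed simp

lemma cinner_scaleR_left: "cinner (r *\<^sub>R x) y = r *\<^sub>R cinner x y"
  unfolding scaleR_scaleC[of r x] by (simp add: cinner_scaleC_left scaleR_conv_of_real)

lemma cinner_scaleR_right: "cinner x (r *\<^sub>R y) = r *\<^sub>R cinner x y"
  unfolding scaleR_scaleC[of r y] by (simp add: cinner_scaleC_right scaleR_conv_of_real)

lemma bounded_linear_cinner_left: "bounded_linear (\<lambda>x. cinner x y)"
  by (rule bounded_linear_intro[where K = "norm y"])
    (simp_all add: cinner_add_left cinner_scaleR_left cmod_cinner_le)

lemma bounded_linear_cinner_right: "bounded_linear (\<lambda>y. cinner x y)"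
  by (rule bounded_linear_intro[where K = "norm x"])
    (simp_all add: cinner_add_right cinner_scaleR_right cmod_cinner_le mult.commute[of _ "norm x"])

lemma scaleC_diff_right: "c *\<^sub>C (x - y) = c *\<^sub>C x - c *\<^sub>C (y::'a::complex_hilbert_space)"
  using scaleC_add_right[of c "x - y" y] by (simp add: algebra_simps)

lemma scaleC_zero_right [simp]: "c *\<^sub>C 0 = (0::'a::complex_hilbert_space)"
  using scaleC_diff_right[of c 0 0] by simp

lemma bounded_linear_scaleC: "bounded_linear (\<lambda>x. c *\<^sub>C (x::'a::complex_hilbert_space))"
proof (rule bounded_linear_intro[where K = "cmod c"])
  show "c *\<^sub>C (r *\<^sub>R x) = r *\<^sub>R (c *\<^sub>C x)" for r and x :: 'a
    by (simp add: scaleR_scaleC scaleC_scaleC mult.commute)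
  show "norm (c *\<^sub>C x) \<le> norm x * cmod c" for x :: 'a
    by (rule power2_le_imp_le) (simp_all add: norm_scaleC_sq power_mult_distrib mult.commute)
qed (rule scaleC_add_right)

section \<open>Orthogonal projection\<close>

text \<open>Complex linear subspaces, not required to be closed.\<close>

definition csubspace :: "'a::complex_hilbert_space set \<Rightarrow> bool"
  where "csubspace S \<longleftrightarrow>
    0 \<in> S \<and> (\<forall>x\<in>S. \<forall>y\<in>S. x + y \<in> S) \<and> (\<forall>c. \<forall>x\<in>S. c *\<^sub>C x \<in> S)"

lemma csubspace_closure:
  assumes "csubspace S"
  shows "csubspace (closure S)"
  unfolding csubspace_def
proof (intro conjI ballI allI)
  show "0 \<in> closure S"
    using assms closure_subset unfolding csubspace_def by blast
next
  fix x y
  assume "x \<in> closure S" and "y \<in> closure S"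
  then obtain f g where f: "\<And>n. f n \<in> S" "f \<longlonglongrightarrow> x" and g: "\<And>n. g n \<in> S" "g \<longlonglongrightarrow> y"
    unfolding closure_sequential by blast
  then have "(\<lambda>n. f n + g n) \<longlonglongrightarrow> x + y" "\<And>n. f n + g n \<in> S"
    using assms unfolding csubspace_def by (auto intro: tendsto_add)
  then show "x + y \<in> closure S"
    unfolding closure_sequential by (intro exI[of _ "\<lambda>n. f n + g n"] conjI allI)
next
  fix c x
  assume "x \<in> closure S"
  then obtain f where f: "\<And>n. f n \<in> S" "f \<longlonglongrightarrow> x"
    unfolding closure_sequential by blast
  then have "(\<lambda>n. c *\<^sub>C f n) \<longlonglongrightarrow> c *\<^sub>C x" "\<And>n. c *\<^sub>C f n \<in> S"
    using assms unfolding csubspace_def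
    by (auto intro: bounded_linear.tendsto[OF bounded_linear_scaleC])
  then show "c *\<^sub>C x \<in> closure S"
    unfolding closure_sequential by (intro exI[of _ "\<lambda>n. c *\<^sub>C f n"] conjI allI)
qed

lemma orthogonal_if_minimal:
  assumes "csubspace S" and "y \<in> S" and min: "\<And>s. s \<in> S \<Longrightarrow> norm z \<le> norm (z - s)"
  shows "cinner z y = 0"
proof (cases "y = 0")
  case False
  let ?c = "cinner z y / complex_of_real ((norm y)\<^sup>2)"
  have "norm z \<le> norm (z - ?c *\<^sub>C y)"
    using assms unfolding csubspace_def by blast
  then have "(norm z)\<^sup>2 \<le> (norm (z - ?c *\<^sub>C y))\<^sup>2"
    by (simp add: power_mono)
  then have "(cmod (cinner z y))\<^sup>2 / (norm y)\<^sup>2 \<le> 0"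
    using norm_sub_component_sq[OF False, of z] by linarith
  with False show ?thesis
    by (simp add: divide_simps)
qed simp

lemma exists_nearest_point:
  assumes "closed S" and S: "csubspace S"
  obtains p where "p \<in> S" and "\<And>s. s \<in> S \<Longrightarrow> norm (x - p) \<le> norm (x - s)"
proof -
  define d where "d = (INF s\<in>S. (norm (x - s))\<^sup>2)"
  have bdd: "bdd_below ((\<lambda>s. (norm (x - s))\<^sup>2) ` S)"
    by (rule bdd_belowI2[where m = 0]) simp
  have d_le: "d \<le> (norm (x - s))\<^sup>2" if "s \<in> S" for s
    unfolding d_def using bdd that by (rule cINF_lower)
  have "S \<noteq> {}"
    using S unfolding csubspace_def by blast
  have "\<exists>s\<in>S. (norm (x - s))\<^sup>2 < d + 1 / real (Suc n)" for n
    using cINF_less_iff[OF \<open>S \<noteq> {}\<close> bdd, of "d + 1 / real (Suc n)"] by (simp add: d_def)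
  then obtain f where fS: "\<And>n. f n \<in> S" and f: "\<And>n. (norm (x - f n))\<^sup>2 < d + 1 / real (Suc n)"
    by metis
  \<comment> \<open>The parallelogram law applied to \<open>x - s\<close> and \<open>x - t\<close>: their mean is \<open>x - m\<close> for a
    point \<open>m\<close> of \<open>S\<close>, so that its squared norm is at least \<open>d\<close>.\<close>
  have near: "(norm (s - t))\<^sup>2 < 4 * e"
    if "s \<in> S" "t \<in> S" "(norm (x - s))\<^sup>2 < d + e" "(norm (x - t))\<^sup>2 < d + e" for s t e
  proof -
    define m where "m = (1/2::real) *\<^sub>R (s + t)"
    have "m \<in> S"
      using S that unfolding m_def csubspace_def scaleR_scaleC by blast
    moreover have eq: "(x - s) + (x - t) = 2 *\<^sub>R (x - m)"
      by (simp add: m_def scaleR_2 algebra_simps flip: scaleR_add_left)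
    have "(norm ((x - s) + (x - t)))\<^sup>2 = 4 * (norm (x - m))\<^sup>2"
      unfolding eq by (simp add: power_mult_distrib)
    ultimately have "4 * d \<le> (norm ((x - s) + (x - t)))\<^sup>2"
      using d_le by simp
    moreover have "(norm (s - t))\<^sup>2 = (norm ((x - s) - (x - t)))\<^sup>2"
      by (simp add: norm_minus_commute)
    ultimately show ?thesis
      using that(3,4) norm_add_sq[of "x - s" "x - t"] norm_diff_sq[of "x - s" "x - t"]
      by linarith
  qed
  have "Cauchy f"
  proof (rule metric_CauchyI)
    fix e :: real
    assume "0 < e"
    then obtain N where N: "1 / real (Suc N) < e\<^sup>2 / 4"
      using reals_Archimedean[of "e\<^sup>2 / 4"] by (auto simp: inverse_eq_divide)
    have "(norm (x - f n))\<^sup>2 < d + e\<^sup>2 / 4" if "n \<ge> N" for n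
    proof -
      have "1 / real (Suc n) \<le> 1 / real (Suc N)"
        using that by (simp add: frac_le)
      then show ?thesis using f[of n] N by linarith
    qed
    then have "(norm (f m - f n))\<^sup>2 < e\<^sup>2" if "m \<ge> N" "n \<ge> N" for m n
      using near[of "f m" "f n" "e\<^sup>2 / 4"] fS that by simp
    then show "\<exists>M. \<forall>m\<ge>M. \<forall>n\<ge>M. dist (f m) (f n) < e"
      using \<open>0 < e\<close> unfolding dist_norm by (meson less_imp_le power_less_imp_less_base)
  qed
  then obtain p where p: "f \<longlonglongrightarrow> p"
    using Cauchy_convergent convergent_def by blast
  have "p \<in> S"
    using \<open>closed S\<close> fS p closed_sequentially by blast
  have "(norm (x - p))\<^sup>2 \<le> d"
  proof (rule LIMSEQ_le)
    show "(\<lambda>n. (norm (x - f n))\<^sup>2) \<longlonglongrightarrow> (norm (x - p))\<^sup>2"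
      by (intro tendsto_intros p)
    show "(\<lambda>n. d + 1 / real (Suc n)) \<longlonglongrightarrow> d"
      using tendsto_add[OF tendsto_const LIMSEQ_Suc[OF lim_1_over_n]] by fastforce
    show "\<exists>N. \<forall>n\<ge>N. (norm (x - f n))\<^sup>2 \<le> d + 1 / real (Suc n)"
      using f less_imp_le by blast
  qed
  then have "norm (x - p) \<le> norm (x - s)" if "s \<in> S" for s
    using power2_le_imp_le[OF order_trans[OF _ d_le[OF that]]] by simp
  with \<open>p \<in> S\<close> show ?thesis
    by (rule that)
qed

lemma orthogonal_projection:
  assumes "closed S" and "csubspace S"
  obtains p where "p \<in> S" and "\<And>s. s \<in> S \<Longrightarrow> cinner (x - p) s = 0"
proof -
  obtain p where p: "p \<in> S" and min: "\<And>s. s \<in> S \<Longrightarrow> norm (x - p) \<le> norm (x - s)"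
    using exists_nearest_point[OF assms] by metis
  have "norm (x - p) \<le> norm (x - p - s)" if "s \<in> S" for s
    using min[of "p + s"] p that assms(2) unfolding csubspace_def by (simp add: algebra_simps)
  then have "cinner (x - p) s = 0" if "s \<in> S" for s
    using orthogonal_if_minimal[OF assms(2) that] by blast
  with p show ?thesis
    by (rule that)
qed

section \<open>Adjoints\<close>

lemma bounded_operator_simps:
  assumes "bounded_operator A"
  shows "A (x + y) = A x + A y" and "A (x - y) = A x - A y" and "A (c *\<^sub>C x) = c *\<^sub>C A x"
    and "A 0 = 0" and "A (- x) = - A x"
  using assms unfolding bounded_operator_def
  by (auto simp: linear_simps)

lemma bounded_operator_compose:
  "bounded_operator A \<Longrightarrow> bounded_operator B \<Longrightarrow> bounded_operator (A \<circ> B)"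
  unfolding bounded_operator_def by (auto simp: o_def intro: bounded_linear_compose)

lemma closed_kernel:
  assumes "bounded_operator A"
  shows "closed (kernel A)"
  unfolding kernel_def using assms
  by (auto simp: bounded_operator_def linear_continuous_on intro!: closed_Collect_eq)

lemma csubspace_kernel:
  assumes "bounded_operator A"
  shows "csubspace (kernel A)"
  by (auto simp: csubspace_def kernel_def bounded_operator_simps[OF assms])

lemma csubspace_range:
  assumes "\<And>x y. A (x + y) = A x + A y" and "\<And>c x. A (c *\<^sub>C x) = c *\<^sub>C A x"
  shows "csubspace (range A)"
proof -
  have "0 = A 0"
    using assms(1)[of 0 0] by simp
  then show ?thesis
    unfolding csubspace_def by (auto simp flip: assms)
qed

text \<open>
  The kernel of a nonzero functional \<open>f\<close> has codimension one, hence \<open>f\<close> is a multiple of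
  \<open>\<lambda>x. cinner x z\<close> for any nonzero \<open>z\<close> orthogonal to the kernel.
\<close>

lemma riesz_representation:
  fixes f :: "'a::complex_hilbert_space \<Rightarrow> complex"
  assumes f: "bounded_linear f" and f_scaleC: "\<And>c x. f (c *\<^sub>C x) = c * f x"
  obtains y where "\<And>x. f x = cinner x y"
proof (cases "\<forall>x. f x = 0")
  case True
  then show ?thesis
    using that[of 0] by simp
next
  case False
  then obtain x0 where x0: "f x0 \<noteq> 0"
    by blast
  let ?K = "{x. f x = 0}"
  have "closed ?K"
    using f by (auto simp: linear_continuous_on intro!: closed_Collect_eq)
  moreover have "csubspace ?K"
    by (simp add: csubspace_def linear_simps[OF f] f_scaleC)
  ultimately obtain p where p: "p \<in> ?K" and orth: "\<And>s. s \<in> ?K \<Longrightarrow> cinner (x0 - p) s = 0"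
    by (rule orthogonal_projection[where x = x0]) blast
  define z where "z = x0 - p"
  have fz: "f z \<noteq> 0"
    using x0 p by (simp add: z_def linear_simps[OF f])
  then have z: "z \<noteq> 0"
    using linear_simps[OF f] by auto
  show ?thesis
  proof (rule that[of "cnj (f z / complex_of_real ((norm z)\<^sup>2)) *\<^sub>C z"])
    fix x
    \<comment> \<open>Any two vectors have a combination in the kernel; pairing it with \<open>z\<close> determines \<open>f x\<close>.\<close>
    have "f (f z *\<^sub>C x - f x *\<^sub>C z) = 0"
      by (simp add: linear_simps[OF f] f_scaleC)
    then have "cinner (f z *\<^sub>C x - f x *\<^sub>C z) z = 0"
      using orth cinner_eq_0_commute unfolding z_def by blast
    then have "f z * cinner x z = f x * complex_of_real ((norm z)\<^sup>2)"
      by (simp add: cinner_diff_left cinner_scaleC_left cinner_self)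
    then show "f x = cinner x (cnj (f z / complex_of_real ((norm z)\<^sup>2)) *\<^sub>C z)"
      using z by (simp add: cinner_scaleC_right divide_simps)
  qed
qed

lemma adjoint_op_unique:
  assumes "\<And>x y. cinner (A x) y = cinner x (S y)"
  shows "adjoint_op A = S"
  unfolding adjoint_op_def
proof (rule the_equality)
  show "\<forall>x y. cinner (A x) y = cinner x (S y)"
    using assms by blast
  show "S' = S" if "\<forall>x y. cinner (A x) y = cinner x (S' y)" for S'
  proof
    show "S' y = S y" for y
      by (rule cinner_left_ext) (metis assms that)
  qed
qed

lemma cinner_adjoint_op:
  assumes A: "bounded_operator A"
  shows "cinner (A x) y = cinner x (adjoint_op A y)"
proof -
  have "\<exists>z. \<forall>x. cinner (A x) y = cinner x z" for y
  proof -
    have "bounded_linear (\<lambda>x. cinner (A x) y)"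
      using A bounded_linear_compose[OF bounded_linear_cinner_left]
      unfolding bounded_operator_def by blast
    then show ?thesis
      by (rule riesz_representation) (auto simp: bounded_operator_simps[OF A] cinner_scaleC_left)
  qed
  then obtain S where "\<And>x y. cinner (A x) y = cinner x (S y)"
    by metis
  then show ?thesis
    using adjoint_op_unique[of A S] by simp
qed

lemma adjoint_op_add:
  assumes A: "bounded_operator A"
  shows "adjoint_op A (x + y) = adjoint_op A x + adjoint_op A y"
  by (rule cinner_left_ext) (simp add: cinner_add_right flip: cinner_adjoint_op[OF A])

lemma adjoint_op_scaleC:
  assumes A: "bounded_operator A"
  shows "adjoint_op A (c *\<^sub>C x) = c *\<^sub>C adjoint_op A x"
  by (rule cinner_left_ext) (simp add: cinner_scaleC_right flip: cinner_adjoint_op[OF A])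

lemma adjoint_op_eq_0_iff:
  assumes A: "bounded_operator A"
  shows "adjoint_op A y = 0 \<longleftrightarrow> (\<forall>x. cinner (A x) y = 0)"
  unfolding cinner_adjoint_op[OF A] by (metis cinner_self_eq_0_iff cinner_zero_right)

text \<open>The inclusion \<open>N(A)\<^sup>\<bottom> \<subseteq> closure (R(A\<^sup>*))\<close>.\<close>

lemma orthogonal_kernel_in_closure_range_adjoint:
  assumes A: "bounded_operator A" and z: "\<And>n. n \<in> kernel A \<Longrightarrow> cinner z n = 0"
  shows "z \<in> closure (range (adjoint_op A))"
proof -
  let ?R = "closure (range (adjoint_op A))"
  have "csubspace ?R"
    by (intro csubspace_closure csubspace_range adjoint_op_add adjoint_op_scaleC A)
  then obtain p where p: "p \<in> ?R" and orth: "\<And>s. s \<in> ?R \<Longrightarrow> cinner (z - p) s = 0"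
    using orthogonal_projection[OF closed_closure] by metis
  have "cinner (A (z - p)) v = 0" for v
    unfolding cinner_adjoint_op[OF A] by (rule orth) (meson closure_subset rangeI subsetD)
  then have "z - p \<in> kernel A"
    unfolding kernel_def using cinner_self_eq_0_iff by blast
  then have "cinner (z - p) (z - p) = 0"
    using z orth[OF p] cinner_eq_0_commute by (metis cinner_diff_left cinner_diff_right diff_self)
  with p show ?thesis
    by simp
qed


section \<open>Moore-Penrose inverses\<close>

text \<open>
  A consequence of the Baire category theorem: the closed sets \<open>{y. norm (f y) \<le> n}\<close> cover the
  space, so that one of them contains a ball.
\<close>

lemma bounded_linear_if_sublevel_sets_closed:
  fixes f :: "'a::banach \<Rightarrow> 'b::real_normed_vector"
  assumes "linear f" and closed: "\<And>n::nat. closed {y. norm (f y) \<le> real n}"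
  shows "bounded_linear f"
proof -
  interpret linear f by fact
  let ?C = "\<lambda>n::nat. {y. norm (f y) \<le> real n}"
  have "(\<Union>n. ?C n) = UNIV"
    using real_arch_simple by auto
  then have "interior (\<Union>(range ?C)) \<noteq> {}"
    by simp
  then obtain n where "interior (?C n) \<noteq> {}"
    using Baire_category_alt[of "euclidean :: 'a topology" "range ?C"] closed
    by (auto simp: completely_metrizable_space_euclidean)
  then obtain a e where "0 < e" and ball: "cball a e \<subseteq> ?C n"
    unfolding interior_def open_contains_cball by blast
  have "norm (f y) \<le> norm y * (2 * real n / e)" for y
  proof (cases "y = 0")
    case False
    define u where "u = (e / norm y) *\<^sub>R y"
    have "norm u = e"
      using False \<open>0 < e\<close> by (simp add: u_def)
    then have "a + u \<in> ?C n" "a \<in> ?C n"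
      using ball \<open>0 < e\<close> by (auto simp: dist_norm subset_iff)
    moreover have "f u = f (a + u) - f a"
      by (simp add: add)
    ultimately have "norm (f u) \<le> 2 * real n"
      using norm_triangle_ineq4[of "f (a + u)" "f a"] by simp
    then have "e / norm y * norm (f y) \<le> 2 * real n"
      using \<open>0 < e\<close> by (simp add: u_def scaleR)
    then show ?thesis
      using False \<open>0 < e\<close> by (simp add: field_simps)
  qed (simp add: zero)
  then show ?thesis
    by (intro bounded_linear_intro[where K = "2 * real n / e"]) (auto simp: add scaleR)
qed

text \<open>
  The vector \<open>X y\<close> is the least squares solution of \<open>T z = y\<close> of minimal norm: the solution of
  the normal equations that is orthogonal to the kernel. Only its boundedness needs the
  completeness of the space beyond orthogonal projections.
\<close>

lemma moore_penrose_existence: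
  assumes T: "bounded_operator T" and closed: "closed (range T)"
  obtains X where "is_moore_penrose T X"
proof -
  note T_simps = bounded_operator_simps[OF T]
  have sub_range: "csubspace (range T)"
    by (rule csubspace_range) (simp_all add: T_simps)
  \<comment> \<open>\<open>z\<close> is orthogonal to the kernel, and \<open>T z\<close> is the projection of \<open>y\<close> onto the range.\<close>
  let ?good = "\<lambda>y z. (\<forall>n\<in>kernel T. cinner z n = 0) \<and> (\<forall>v. cinner (y - T z) (T v) = 0)"
  have "\<exists>z. ?good y z" for y
  proof -
    obtain w where w: "\<And>v. cinner (y - T w) (T v) = 0"
      using orthogonal_projection[OF closed sub_range, of y] by (metis rangeE rangeI)
    obtain p where p: "p \<in> kernel T" and orth: "\<And>n. n \<in> kernel T \<Longrightarrow> cinner (w - p) n = 0"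
      using orthogonal_projection[OF closed_kernel[OF T] csubspace_kernel[OF T], of w] by metis
    have "T (w - p) = T w"
      using p by (simp add: T_simps kernel_def)
    with w orth show ?thesis
      by metis
  qed
  then obtain X where good: "\<And>y. ?good y (X y)"
    by metis
  then have X_kernel: "\<And>y n. n \<in> kernel T \<Longrightarrow> cinner (X y) n = 0"
    and X_range: "\<And>y v. cinner (y - T (X y)) (T v) = 0"
    by blast+
  have good_unique: "z = z'" if "?good y z" "?good y z'" for y z z'
  proof -
    have "cinner (T (z - z')) (T v) = 0" for v
    proof -
      have "T (z - z') = (y - T z') - (y - T z)"
        by (simp add: T_simps)
      then show ?thesis
        using that by (simp only: cinner_diff_left) simp
    qed
    then have "z - z' \<in> kernel T"
      using cinner_self_eq_0_iff unfolding kernel_def by blast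
    then have "cinner (z - z') (z - z') = 0"
      using that unfolding cinner_diff_left[of z z'] by simp
    then show "z = z'"
      by simp
  qed
  have X_add: "X (x + y) = X x + X y" for x y
  proof (rule good_unique[OF good])
    have "x + y - T (X x + X y) = (x - T (X x)) + (y - T (X y))"
      by (simp add: T_simps)
    then show "?good (x + y) (X x + X y)"
      using good[of x] good[of y] by (simp only: cinner_add_left) simp
  qed
  have X_scaleC: "X (c *\<^sub>C x) = c *\<^sub>C X x" for c x
  proof (rule good_unique[OF good])
    have "c *\<^sub>C x - T (c *\<^sub>C X x) = c *\<^sub>C (x - T (X x))"
      by (simp add: T_simps scaleC_diff_right)
    then show "?good (c *\<^sub>C x) (c *\<^sub>C X x)"
      using good[of x] by (simp only: cinner_scaleC_left) simp
  qed
  have lin: "linear X"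
    by (rule linearI) (simp_all add: X_add X_scaleC scaleR_scaleC[where 'a = 'a])
  have TXT: "T (X (T x)) = T x" for x
  proof -
    have "T x - T (X (T x)) = T (x - X (T x))"
      by (simp add: T_simps)
    then show ?thesis
      using X_range[of "T x" "x - X (T x)"] by simp
  qed
  have XTX: "X (T (X y)) = X y" for y
    by (rule good_unique[OF good]) (simp add: X_kernel)
  have TX_sym: "cinner (T (X x)) y = cinner x (T (X y))" for x y
  proof -
    have "cinner (T (X x)) (y - T (X y)) = 0"
      using X_range cinner_eq_0_commute by blast
    then show ?thesis
      using X_range[of x "X y"] by (simp add: cinner_diff_left cinner_diff_right)
  qed
  have XT_sym: "cinner (X (T x)) y = cinner x (X (T y))" for x y
  proof -
    have ker: "w - X (T w) \<in> kernel T" for w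
      by (simp add: kernel_def T_simps TXT)
    have "cinner (X (T x)) (y - X (T y)) = 0" "cinner (x - X (T x)) (X (T y)) = 0"
      using X_kernel[OF ker] cinner_eq_0_commute by blast+
    then show ?thesis
      by (simp add: cinner_diff_left cinner_diff_right)
  qed
  have norm_TX: "norm (T (X y)) \<le> norm y" for y
  proof -
    have "cinner (T (X y)) (T (X y)) = cinner y (T (X y))"
      by (simp add: TX_sym XTX)
    then have "(norm (T (X y)))\<^sup>2 \<le> norm y * norm (T (X y))"
      using cmod_cinner_le[of y "T (X y)"] by (metis cinner_self norm_of_real abs_power2)
    then show ?thesis
      by (cases "T (X y) = 0") (simp_all add: power2_eq_square)
  qed
  have "bounded_linear (\<lambda>y. T (X y))"
    using norm_TX linear_compose[OF lin] T
    by (intro bounded_linear_intro[where K = 1])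
      (auto simp: X_add T_simps linear_scale[OF lin] bounded_operator_def linear_simps)
  then have TX_cont: "continuous_on UNIV (\<lambda>y. cinner (T (X y)) v)" for v
    by (intro linear_continuous_on bounded_linear_compose[OF bounded_linear_cinner_left])
  \<comment> \<open>\<open>X y\<close> is tested against the vectors \<open>adjoint_op T v\<close> only: they are dense in the orthogonal
    complement of the kernel, and \<open>cinner (X y) (adjoint_op T v) = cinner (T (X y)) v\<close> depends
    continuously on \<open>y\<close> although the continuity of \<open>X\<close> is not known yet.\<close>
  have sublevel: "norm (X y) \<le> real n \<longleftrightarrow>
      (\<forall>v. cmod (cinner (T (X y)) v) \<le> real n * norm (adjoint_op T v))" for y n
  proof
    assume le: "norm (X y) \<le> real n"
    show "\<forall>v. cmod (cinner (T (X y)) v) \<le> real n * norm (adjoint_op T v)"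
    proof
      fix v
      have "cmod (cinner (X y) (adjoint_op T v)) \<le> norm (X y) * norm (adjoint_op T v)"
        by (rule cmod_cinner_le)
      also have "\<dots> \<le> real n * norm (adjoint_op T v)"
        using le by (simp add: mult_right_mono)
      finally show "cmod (cinner (T (X y)) v) \<le> real n * norm (adjoint_op T v)"
        by (simp add: cinner_adjoint_op[OF T])
    qed
  next
    assume le: "\<forall>v. cmod (cinner (T (X y)) v) \<le> real n * norm (adjoint_op T v)"
    let ?U = "{u. cmod (cinner (X y) u) \<le> real n * norm u}"
    have "closed ?U"
      by (intro closed_Collect_le continuous_intros linear_continuous_on bounded_linear_cinner_right)
    moreover have "range (adjoint_op T) \<subseteq> ?U"
      using le by (auto simp: cinner_adjoint_op[OF T])
    ultimately have "closure (range (adjoint_op T)) \<subseteq> ?U"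
      by (rule closure_minimal[rotated])
    then have "cmod (cinner (X y) (X y)) \<le> real n * norm (X y)"
      using orthogonal_kernel_in_closure_range_adjoint[OF T X_kernel] by blast
    then show "norm (X y) \<le> real n"
      by (cases "X y = 0") (simp_all add: cinner_self power2_eq_square norm_mult)
  qed
  have "bounded_linear X"
  proof (rule bounded_linear_if_sublevel_sets_closed[OF lin])
    show "closed {y. norm (X y) \<le> real n}" for n
      unfolding sublevel
      by (intro closed_Collect_all closed_Collect_le continuous_intros TX_cont)
  qed
  then have "bounded_operator X"
    by (simp add: bounded_operator_def X_scaleC)
  moreover have "T \<circ> X \<circ> T = T" "X \<circ> T \<circ> X = X"
    by (simp_all add: fun_eq_iff TXT XTX)
  moreover have "adjoint_op (T \<circ> X) = T \<circ> X" "adjoint_op (X \<circ> T) = X \<circ> T"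
    by (rule adjoint_op_unique, simp add: TX_sym XT_sym)+
  ultimately have "is_moore_penrose T X"
    by (simp add: is_moore_penrose_def)
  then show ?thesis
    by (rule that)
qed

text \<open>The two identities are adjoint to each other.\<close>

lemma self_adjoint_absorb_iff:
  assumes A: "bounded_operator A" "adjoint_op A = A"
    and B: "bounded_operator B" "adjoint_op B = B"
  shows "A \<circ> B = A \<longleftrightarrow> B \<circ> A = A"
proof -
  have A_sym: "cinner (A x) y = cinner x (A y)" and B_sym: "cinner (B x) y = cinner x (B y)" for x y
    using cinner_adjoint_op[OF A(1)] cinner_adjoint_op[OF B(1)] A(2) B(2) by simp_all
  show ?thesis
  proof
    assume AB: "A \<circ> B = A"
    have "cinner x (B (A y)) = cinner x (A y)" for x y
      using A_sym B_sym AB by (metis comp_apply)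
    then show "B \<circ> A = A"
      by (auto simp: fun_eq_iff intro: cinner_left_ext)
  next
    assume BA: "B \<circ> A = A"
    have "cinner x (A (B y)) = cinner x (A y)" for x y
      using A_sym B_sym BA by (metis comp_apply)
    then show "A \<circ> B = A"
      by (auto simp: fun_eq_iff intro: cinner_left_ext)
  qed
qed

lemma moore_penrose_unique:
  assumes T: "bounded_operator T" and X: "is_moore_penrose T X" and Y: "is_moore_penrose T Y"
  shows "X = Y"
proof -
  have X': "T \<circ> X \<circ> T = T" "X \<circ> T \<circ> X = X" "bounded_operator X"
      "adjoint_op (T \<circ> X) = T \<circ> X" "adjoint_op (X \<circ> T) = X \<circ> T"
    and Y': "T \<circ> Y \<circ> T = T" "Y \<circ> T \<circ> Y = Y" "bounded_operator Y"
      "adjoint_op (T \<circ> Y) = T \<circ> Y" "adjoint_op (Y \<circ> T) = Y \<circ> T"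
    using X Y unfolding is_moore_penrose_def by blast+
  have "(T \<circ> Y) \<circ> (T \<circ> X) = T \<circ> X" "(X \<circ> T) \<circ> (Y \<circ> T) = X \<circ> T"
    using Y'(1) by (metis comp_assoc)+
  then have "(T \<circ> X) \<circ> (T \<circ> Y) = T \<circ> X" "(Y \<circ> T) \<circ> (X \<circ> T) = X \<circ> T"
    using self_adjoint_absorb_iff X' Y' T by (metis bounded_operator_compose)+
  moreover have "(T \<circ> X) \<circ> (T \<circ> Y) = T \<circ> Y" "(Y \<circ> T) \<circ> (X \<circ> T) = Y \<circ> T"
    using X'(1) by (metis comp_assoc)+
  ultimately have TX: "T \<circ> X = T \<circ> Y" and "X \<circ> T = Y \<circ> T"
    by simp_all
  with TX show "X = Y"
    using X'(2) Y'(2) by (metis comp_assoc)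
qed

lemma is_moore_penrose_moore_penrose:
  assumes "bounded_operator T" and "closed (range T)"
  shows "is_moore_penrose T (moore_penrose T)"
  unfolding moore_penrose_def
  using moore_penrose_existence[OF assms] moore_penrose_unique[OF assms(1)] by (metis theI)

section \<open>EP operators\<close>

lemma kernel_moore_penrose:
  assumes T: "bounded_operator T" and X: "is_moore_penrose T X"
  shows "kernel X = kernel (adjoint_op T)"
proof -
  have bX: "bounded_operator X" and sym: "adjoint_op (T \<circ> X) = T \<circ> X"
    and TXT: "\<And>x. T (X (T x)) = T x" and XTX: "\<And>x. X (T (X x)) = X x"
    using X unfolding is_moore_penrose_def by (auto simp: fun_eq_iff)
  have TX_sym: "cinner (T (X x)) y = cinner x (T (X y))" for x y
    using cinner_adjoint_op[OF bounded_operator_compose[OF T bX]] sym by (metis comp_apply)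
  have "X y = 0 \<longleftrightarrow> (\<forall>x. cinner (T x) y = 0)" for y
  proof
    assume "X y = 0"
    then show "\<forall>x. cinner (T x) y = 0"
      by (metis TXT TX_sym bounded_operator_simps(4)[OF T] cinner_zero_right)
  next
    assume "\<forall>x. cinner (T x) y = 0"
    then have "cinner x (T (X y)) = cinner x 0" for x
      using TX_sym[of x y] by simp
    then have "T (X y) = 0"
      by (rule cinner_left_ext)
    then show "X y = 0"
      by (metis XTX bounded_operator_simps(4)[OF bX])
  qed
  then show ?thesis
    by (simp add: kernel_def adjoint_op_eq_0_iff[OF T])
qed

text \<open>
  \<open>T \<circ> X\<close> and \<open>X \<circ> T\<close> are orthogonal projections; their kernels are those of \<open>X\<close> and of \<open>T\<close>,
  and an orthogonal projection is determined by its kernel.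
\<close>

lemma moore_penrose_commute_if_kernel_eq:
  assumes T: "bounded_operator T" and X: "is_moore_penrose T X" and ker: "kernel T = kernel X"
  shows "T \<circ> X = X \<circ> T"
proof -
  have X': "T \<circ> X \<circ> T = T" "X \<circ> T \<circ> X = X" "bounded_operator X"
      "adjoint_op (T \<circ> X) = T \<circ> X" "adjoint_op (X \<circ> T) = X \<circ> T"
    using X unfolding is_moore_penrose_def by blast+
  note simps = bounded_operator_simps[OF T] bounded_operator_simps[OF X'(3)]
  have TXT: "T (X (T x)) = T x" and XTX: "X (T (X x)) = X x" for x
    using X'(1,2) by (auto simp: fun_eq_iff)
  have "x - X (T x) \<in> kernel X" for x
    unfolding ker[symmetric] by (simp add: kernel_def simps TXT)
  then have 1: "(T \<circ> X) \<circ> (X \<circ> T) = T \<circ> X"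
    by (auto simp: kernel_def simps fun_eq_iff)
  have "x - T (X x) \<in> kernel T" for x
    unfolding ker by (simp add: kernel_def simps XTX)
  then have "(X \<circ> T) \<circ> (T \<circ> X) = X \<circ> T"
    by (auto simp: kernel_def simps fun_eq_iff)
  moreover have "(X \<circ> T) \<circ> (T \<circ> X) = T \<circ> X"
    using 1 self_adjoint_absorb_iff X' T by (metis bounded_operator_compose)
  ultimately show ?thesis
    by simp
qed

text \<open>
  The square \<open>X \<circ> X\<close> satisfies both identities but vanishes on the kernel of \<open>T\<close>; adding the
  projection onto that kernel makes it invertible and changes neither \<open>V \<circ> T\<close> nor \<open>T \<circ> V\<close>.
\<close>

lemma isomorphism_if_kernel_eq:
  assumes T: "bounded_operator T" and X: "is_moore_penrose T X" and ker: "kernel T = kernel X"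
  obtains V where "isomorphism_op V" and "X = V \<circ> T" and "X = T \<circ> V"
proof -
  have bX: "bounded_operator X"
    and TXT: "\<And>x. T (X (T x)) = T x" and XTX: "\<And>x. X (T (X x)) = X x"
    using X unfolding is_moore_penrose_def by (auto simp: fun_eq_iff)
  have comm: "X (T x) = T (X x)" for x
    using moore_penrose_commute_if_kernel_eq[OF T X ker] by (metis comp_apply)
  note simps = bounded_operator_simps[OF T] bounded_operator_simps[OF bX]
  have TTX: "T (T (X x)) = T x" and XTX': "T (X (X x)) = X x" for x
    using TXT XTX by (simp_all add: comm)
  \<comment> \<open>\<open>W\<close> is the inverse of \<open>V\<close>: on the range of \<open>T\<close>, where \<open>X\<close> inverts \<open>T\<close>, they are \<open>T \<circ> T\<close>
    and \<open>X \<circ> X\<close>; on the kernel of \<open>T\<close>, the orthogonal complement of that range, both are the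
    identity.\<close>
  define V where "V = (\<lambda>x. X (X x) + (x - T (X x)))"
  define W where "W = (\<lambda>x. T (T x) + (x - T (X x)))"
  have "V (W x) = x" "W (V x) = x" for x
    by (simp_all add: V_def W_def simps comm TTX XTX')
  then have "inj V" "surj V"
    by (metis injI, metis surjI)
  moreover have "bounded_operator V"
  proof -
    have bl: "bounded_linear T" "bounded_linear X"
      using T bX by (simp_all add: bounded_operator_def)
    have "bounded_linear V"
      unfolding V_def
      by (intro bounded_linear_add bounded_linear_sub bounded_linear_ident
          bounded_linear_compose[OF bl(1)] bounded_linear_compose[OF bl(2)] bl)
    then show ?thesis
      by (simp add: bounded_operator_def V_def simps scaleC_add_right scaleC_diff_right)
  qed
  ultimately have "isomorphism_op V"
    by (simp add: isomorphism_op_def)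
  moreover have "X = V \<circ> T" "X = T \<circ> V"
    by (auto simp: fun_eq_iff V_def simps comm TTX XTX')
  ultimately show ?thesis
    by (rule that)
qed

theorem proposition4p3:
  fixes T :: "'a::complex_hilbert_space \<Rightarrow> 'a"
  assumes "bounded_operator T"
    and "closed (range T)"
  shows "(EP T \<longleftrightarrow>
           (\<exists>V. isomorphism_op V \<and> moore_penrose T = V \<circ> T \<and> moore_penrose T = T \<circ> V)) \<and>
         (EP T \<longleftrightarrow>
           (\<exists>N. bounded_operator N \<and> inj N \<and> moore_penrose T = N \<circ> T)) \<and>
         (EP T \<longleftrightarrow>
           (\<exists>S1 S2. bounded_operator S1 \<and> bounded_operator S2 \<and>
              moore_penrose T = S1 \<circ> T \<and> T = S2 \<circ> moore_penrose T))"
    (is "(_ \<longleftrightarrow> ?iso) \<and> (_ \<longleftrightarrow> ?inj) \<and> (_ \<longleftrightarrow> ?factor)")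
proof -
  let ?X = "moore_penrose T"
  note T = assms(1)
  note X = is_moore_penrose_moore_penrose[OF assms]
  have EP_iff: "EP T \<longleftrightarrow> kernel T = kernel ?X"
    by (simp add: EP_def assms kernel_moore_penrose[OF T X])
  have kernel_mono: "kernel A \<subseteq> kernel (S \<circ> A)" if "bounded_operator S" for A S
    using bounded_operator_simps(4)[OF that] by (auto simp: kernel_def)
  have iso: ?iso if "EP T"
    using isomorphism_if_kernel_eq[OF T X] that EP_iff by metis
  moreover have inj: ?inj if ?iso
    using that unfolding isomorphism_op_def by blast
  moreover have EP_if_inj: "EP T" if ?inj
  proof -
    from that obtain N where N: "bounded_operator N" "inj N" "?X = N \<circ> T"
      by blast
    then have "N (T x) = 0 \<longleftrightarrow> T x = 0" for x
      using bounded_operator_simps(4)[OF N(1)] by (metis injD)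
    then show ?thesis
      unfolding EP_iff N(3) kernel_def by simp
  qed
  moreover have ?factor if EP: "EP T"
  proof -
    obtain V where V: "isomorphism_op V" "?X = V \<circ> T"
      using iso[OF EP] by blast
    have "T \<circ> ?X = ?X \<circ> T"
      using moore_penrose_commute_if_kernel_eq[OF T X] EP EP_iff by blast
    moreover have "T \<circ> ?X \<circ> T = T"
      using X unfolding is_moore_penrose_def by blast
    \<comment> \<open>Hence the second factor can be taken to be \<open>T \<circ> T\<close>.\<close>
    ultimately have "T = (T \<circ> T) \<circ> ?X"
      by (metis comp_assoc)
    with V show ?thesis
      using T bounded_operator_compose unfolding isomorphism_op_def by blast
  qed
  moreover have "EP T" if ?factor
    using that kernel_mono unfolding EP_iff by (metis subset_antisym)
  ultimately show ?thesis
    by blast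
qed

end
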